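(* There is an absolute constant $c$ such that the following holds. Let $X$ be a semi-permutation, $T$ a partitioning tree for $X$, $U\subseteq V(T)$ a set of vertices such that every root-to-leaf path of $T$ contains exactly one vertex of $U$, and $(X^c,\{X^s_v\}_{v\in U})$ the split of $(X,T)$ at $U$. Then $$\mathrm{WB}(X)\le 4\,\mathrm{WB}(X^c)+8\sum_{v\in U}\mathrm{WB}(X^s_v)+c\,|X|.$$
   Context: Points have integer coordinates; a row (column) is active for $X$ if it contains a point of $X$; $X$ is a semi-permutation if each active row contains exactly one point of $X$. Strong Wilber bound: for a semi-permutation $Z$ with bounding box $B_Z$, let $\mathcal L(Z)$ be the vertical lines with half-integral $x$-coordinate strictly between the minimum and maximum $x$-coordinates of $Z$. For an ordering $\sigma$ of $\mathcal L(Z)$, process lines in order starting from the partition $\{B_Z\}$; each line $L$ splits the current vertical strip $S$ containing it into two, and is charged the number of indices $j$ such that $q_j,q_{j+1}$ lie on opposite sides of $L$, where $q_1,\dots,q_z$ are the points of $Z\cap S$ in increasing $y$-order. $\mathrm{WB}_\sigma(Z)$ is the total charge and $\mathrm{WB}(Z)=\max_\sigma\mathrm{WB}_\sigma(Z)$ ($=0$ if $Z$ has one active column). Partitioning tree for $X$: a rooted binary tree whose vertices $v$ carry closed vertical strips $S(v)$: the root carries the bounding box of $X$; an internal vertex $v$ owns a line $L(v)\in\mathcal L(X)$ strictly inside $S(v)$, and its two children carry the two strips into which $L(v)$ splits $S(v)$; each leaf strip contains exactly one active column of $X$. Split at $U$: for $v\in U$, $X^s_v=X\cap S(v)$; the compressed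 instance $X^c$ replaces, for each $v\in U$, every point $p\in X\cap S(v)$ by $(x_v,p.y)$, where $x_v$ is the $x$-coordinate of the leftmost active column of $X$ in $S(v)$. *)

theory Defs
  imports Complex_Main
begin

type_synonym point = "int \<times> int"

text \<open>A vertical line with half-integral x-coordinate k + 1/2 is represented by the integer k.
  A point p lies to the left of line k iff fst p \<le> k.\<close>

definition semi_perm :: "point set \<Rightarrow> bool" where
  "semi_perm X \<longleftrightarrow> finite X \<and> (\<forall>p\<in>X. \<forall>q\<in>X. snd p = snd q \<longrightarrow> p = q)"

definition lines :: "point set \<Rightarrow> int set" where
  "lines Z = {k. \<exists>p\<in>Z. \<exists>q\<in>Z. fst p \<le> k \<and> k < fst q}"

definition charge :: "point set \<Rightarrow> int \<Rightarrow> nat" where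
  "charge P k = card {(p, q). p \<in> P \<and> q \<in> P \<and> snd p < snd q \<and>
       \<not> (\<exists>r\<in>P. snd p < snd r \<and> snd r < snd q) \<and> ((fst p \<le> k) \<noteq> (fst q \<le> k))}"

text \<open>Points of Z in the current strip containing line (\<sigma> ! i), after lines \<sigma>!0..\<sigma>!(i-1).\<close>
definition strip_pts :: "point set \<Rightarrow> int list \<Rightarrow> nat \<Rightarrow> point set" where
  "strip_pts Z \<sigma> i = {p \<in> Z. \<forall>j<i. (fst p \<le> \<sigma> ! j) = (\<sigma> ! i \<le> \<sigma> ! j)}"

definition WB_sigma :: "point set \<Rightarrow> int list \<Rightarrow> nat" where
  "WB_sigma Z \<sigma> = (\<Sum>i<length \<sigma>. charge (strip_pts Z \<sigma> i) (\<sigma> ! i))"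

definition WB :: "point set \<Rightarrow> nat" where
  "WB Z = Max {WB_sigma Z \<sigma> | \<sigma>. distinct \<sigma> \<and> set \<sigma> = lines Z}"

text \<open>Partitioning trees. An internal node stores its line k. A strip is represented by the
  closed integer range [lo, hi] of x-coordinates it contains; line k splits it into
  [lo, k] and [k+1, hi].\<close>
datatype ptree = Leaf | Node int ptree ptree

definition active_cols :: "point set \<Rightarrow> int \<Rightarrow> int \<Rightarrow> int set" where
  "active_cols X lo hi = {x. \<exists>p\<in>X. fst p = x \<and> lo \<le> x \<and> x \<le> hi}"

fun wf_ptree :: "point set \<Rightarrow> int \<Rightarrow> int \<Rightarrow> ptree \<Rightarrow> bool" where
  "wf_ptree X lo hi Leaf \<longleftrightarrow> card (active_cols X lo hi) = 1"
| "wf_ptree X lo hi (Node k l r) \<longleftrightarrow> k \<in> lines X \<and> lo \<le> k \<and> k < hi \<and>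
       wf_ptree X lo k l \<and> wf_ptree X (k + 1) hi r"

definition partitioning_tree :: "point set \<Rightarrow> ptree \<Rightarrow> bool" where
  "partitioning_tree X T \<longleftrightarrow> X \<noteq> {} \<and> wf_ptree X (Min (fst ` X)) (Max (fst ` X)) T"

fun positions :: "ptree \<Rightarrow> bool list set" where
  "positions Leaf = {[]}"
| "positions (Node k l r) = insert [] (Cons False ` positions l \<union> Cons True ` positions r)"

fun leaf_positions :: "ptree \<Rightarrow> bool list set" where
  "leaf_positions Leaf = {[]}"
| "leaf_positions (Node k l r) = Cons False ` leaf_positions l \<union> Cons True ` leaf_positions r"

fun strip_of :: "ptree \<Rightarrow> int \<Rightarrow> int \<Rightarrow> bool list \<Rightarrow> int \<times> int" where
  "strip_of t lo hi [] = (lo, hi)"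
| "strip_of (Node k l r) lo hi (False # v) = strip_of l lo k v"
| "strip_of (Node k l r) lo hi (True # v) = strip_of r (k + 1) hi v"
| "strip_of Leaf lo hi (b # v) = (lo, hi)"

definition vstrip :: "point set \<Rightarrow> ptree \<Rightarrow> bool list \<Rightarrow> int \<times> int" where
  "vstrip X T v = strip_of T (Min (fst ` X)) (Max (fst ` X)) v"

definition cut_set :: "ptree \<Rightarrow> bool list set \<Rightarrow> bool" where
  "cut_set T U \<longleftrightarrow> U \<subseteq> positions T \<and>
     (\<forall>p\<in>leaf_positions T. \<exists>!i. i \<le> length p \<and> take i p \<in> U)"

definition split_s :: "point set \<Rightarrow> ptree \<Rightarrow> bool list \<Rightarrow> point set" where
  "split_s X T v = {p \<in> X. fst (vstrip X T v) \<le> fst p \<and> fst p \<le> snd (vstrip X T v)}"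

definition split_c :: "point set \<Rightarrow> ptree \<Rightarrow> bool list set \<Rightarrow> point set" where
  "split_c X T U = (\<Union>v\<in>U. (\<lambda>p. (Min (fst ` split_s X T v), snd p)) ` split_s X T v)"

end

theory Submission
  imports Defs
begin

text \<open>
  Fix an optimal ordering for \<open>X\<close>. Its cost is the number of links, a link being a pair of points that
  are consecutive in the current strip when a line first separates them.
  Links within one block \<open>X \<inter> S(v)\<close> are crossings of the induced ordering of that block.
  If the separating line runs inside the block of one of its end points, that end point is cut off from
  everything beyond its block on that side, so each point takes part in few such links.

  For the remaining links, orient every block to the left or to the right at random and let a line inside
  a block act on the compressed instance as the line just right (resp. left) of the column of that block.
  A remaining link survives in the resulting ordering of the compressed instance as soon as the block of
  its left end is oriented to the right and the block of its right end to the left, which happens with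
  probability 1/4; hence the factor 4.
\<close>

section \<open>Crossings and orderings\<close>

definition crossings :: "point set \<Rightarrow> int \<Rightarrow> (point \<times> point) set" where
  "crossings P k = {(p, q). p \<in> P \<and> q \<in> P \<and> snd p < snd q \<and>
       \<not> (\<exists>r\<in>P. snd p < snd r \<and> snd r < snd q) \<and> ((fst p \<le> k) \<noteq> (fst q \<le> k))}"

text \<open>Orderings of the lines are given by time stamps \<open>T\<close>; a strip depends only on the earlier lines.\<close>

definition strip :: "point set \<Rightarrow> (int \<Rightarrow> nat) \<Rightarrow> int \<Rightarrow> point set" where
  "strip Z T k = {p \<in> Z. \<forall>j. T j < T k \<longrightarrow> (fst p \<le> j) = (k \<le> j)}"

lemma charge_eq_card: "charge P k = card (crossings P k)"
  by (simp add: charge_def crossings_def)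

lemma crossingsD:
  assumes "(p, q) \<in> crossings P k"
  shows "p \<in> P" "q \<in> P" "snd p < snd q" "(fst p \<le> k) \<noteq> (fst q \<le> k)"
    "r \<in> P \<Longrightarrow> \<not> (snd p < snd r \<and> snd r < snd q)"
  using assms unfolding crossings_def by blast+

lemma finite_crossings: "finite P \<Longrightarrow> finite (crossings P k)"
  by (rule finite_subset[of _ "P \<times> P"]) (auto simp: crossings_def)

lemma finite_strip: "finite Z \<Longrightarrow> finite (strip Z T k)"
  by (simp add: strip_def)

section \<open>Finiteness of the maximum and its attainment\<close>

lemma finite_lines:
  assumes "finite Z" shows "finite (lines Z)"
proof -
  have "lines Z \<subseteq> (\<Union>p\<in>Z. \<Union>q\<in>Z. {fst p..<fst q})" by (fastforce simp: lines_def)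
  then show ?thesis using assms by (auto intro: finite_subset)
qed

lemma lines_mono: "A \<subseteq> B \<Longrightarrow> lines A \<subseteq> lines B"
  by (auto simp: lines_def)

lemma finite_WB_set:
  assumes "finite Z"
  shows "finite {WB_sigma Z \<sigma> | \<sigma>. distinct \<sigma> \<and> set \<sigma> = lines Z}"
proof -
  have "finite {\<sigma>. set \<sigma> \<subseteq> lines Z \<and> distinct \<sigma>}"
    using finite_subset_distinct[OF finite_lines[OF assms]] .
  then have "finite (WB_sigma Z ` {\<sigma>. distinct \<sigma> \<and> set \<sigma> = lines Z})"
    by (intro finite_imageI) (auto elim!: rev_finite_subset)
  then show ?thesis by (simp add: setcompr_eq_image)
qed

lemma WB_sigma_le_WB:
  assumes "finite Z" "distinct \<sigma>" "set \<sigma> = lines Z"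
  shows "WB_sigma Z \<sigma> \<le> WB Z"
  unfolding WB_def by (rule Max_ge[OF finite_WB_set]) (use assms in auto)

lemma WB_attained:
  assumes "finite Z"
  obtains \<sigma> where "distinct \<sigma>" "set \<sigma> = lines Z" "WB Z = WB_sigma Z \<sigma>"
proof -
  have "{WB_sigma Z \<sigma> | \<sigma>. distinct \<sigma> \<and> set \<sigma> = lines Z} \<noteq> {}"
    using finite_distinct_list[OF finite_lines[OF assms]] by auto
  from Max_in[OF finite_WB_set[OF assms] this] show ?thesis
    using that by (auto simp: WB_def)
qed

section \<open>From orderings to time stamps and back\<close>

text \<open>Such a line \<open>j\<close> has all of \<open>Z\<close> on one side, while
  \<open>k\<close> has points of \<open>Z\<close> on both sides. Hence stamps of integers outside
  \<open>lines Z\<close> put no constraint on the strip of a line of \<open>Z\<close>.\<close>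

lemma same_side_of_outer_line:
  assumes "p \<in> Z" "k \<in> lines Z" "j \<notin> lines Z"
  shows "(fst p \<le> j) = (k \<le> j)"
proof
  assume pj: "fst p \<le> j"
  obtain q where "q \<in> Z" "k < fst q" using assms(2) by (auto simp: lines_def)
  moreover have "\<not> j < fst q" using assms(1,3) pj \<open>q \<in> Z\<close> by (auto simp: lines_def)
  ultimately show "k \<le> j" by simp
next
  assume kj: "k \<le> j"
  obtain q where "q \<in> Z" "fst q \<le> k" using assms(2) by (auto simp: lines_def)
  moreover have "\<not> (fst q \<le> j \<and> j < fst p)" using assms(1,3) \<open>q \<in> Z\<close> unfolding lines_def by blast
  ultimately show "fst p \<le> j" using kj by auto
qed

lemma strip_pts_eq_strip:
  assumes "i < length \<sigma>" "set \<sigma> = lines Z"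
    and T: "\<And>j. j < length \<sigma> \<Longrightarrow> T (\<sigma> ! j) < T (\<sigma> ! i) \<longleftrightarrow> j < i"
  shows "strip_pts Z \<sigma> i = strip Z T (\<sigma> ! i)"
proof -
  have "(\<forall>j<i. (fst p \<le> \<sigma> ! j) = (\<sigma> ! i \<le> \<sigma> ! j)) \<longleftrightarrow>
        (\<forall>j. T j < T (\<sigma> ! i) \<longrightarrow> (fst p \<le> j) = (\<sigma> ! i \<le> j))" (is "?L \<longleftrightarrow> ?R") if "p \<in> Z" for p
  proof
    assume L: ?L
    show ?R
    proof (intro allI impI)
      fix j assume j: "T j < T (\<sigma> ! i)"
      show "(fst p \<le> j) = (\<sigma> ! i \<le> j)"
      proof (cases "j \<in> lines Z")
        case True
        then obtain n where "n < length \<sigma>" "j = \<sigma> ! n" using assms(2) by (metis in_set_conv_nth)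
        then show ?thesis using T j L by auto
      next
        case False
        then show ?thesis using same_side_of_outer_line that assms(1,2) nth_mem by blast
      qed
    qed
  next
    assume ?R
    then show ?L using T assms(1) by auto
  qed
  then show ?thesis by (auto simp: strip_pts_def strip_def)
qed

text \<open>Only the set of earlier lines matters to a strip, so ties among uncounted lines can be
  broken at will, and the lines outside \<open>K\<close> can only add to the cost of the resulting
  ordering.\<close>

lemma sum_charge_le_WB:
  assumes "finite Z" "K \<subseteq> lines Z"
    and uniq: "\<And>j k. k \<in> K \<Longrightarrow> j \<in> lines Z \<Longrightarrow> T j = T k \<Longrightarrow> j = k"
  shows "(\<Sum>k\<in>K. charge (strip Z T k) k) \<le> WB Z"
proof -
  note fin = finite_lines[OF assms(1)]
  \<comment> \<open>Sorting by stamp; two lines of \<open>Z\<close> can tie only if both lie outside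
    \<open>K\<close>.\<close>
  define \<sigma> where "\<sigma> = sort_key T (sorted_list_of_set (lines Z))"
  have d: "distinct \<sigma>" and s: "set \<sigma> = lines Z" using fin by (auto simp: \<sigma>_def)
  have srt: "sorted (map T \<sigma>)" by (simp add: \<sigma>_def)
  define I where "I = {i. i < length \<sigma> \<and> \<sigma> ! i \<in> K}"
  have K: "K = (!) \<sigma> ` I"
    using assms(2) unfolding I_def s[symmetric] by (auto simp: in_set_conv_nth subset_iff image_iff)
  have inj: "inj_on ((!) \<sigma>) I" using d by (auto simp: inj_on_def I_def nth_eq_iff_index_eq)
  have strip: "strip_pts Z \<sigma> i = strip Z T (\<sigma> ! i)" if "i \<in> I" for i
  proof (rule strip_pts_eq_strip)
    show "i < length \<sigma>" "set \<sigma> = lines Z" using that s by (auto simp: I_def)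
    fix j assume j: "j < length \<sigma>"
    have "T (\<sigma> ! j) \<noteq> T (\<sigma> ! i)" if "j \<noteq> i"
      using uniq[of "\<sigma> ! i" "\<sigma> ! j"] \<open>i \<in> I\<close> j d that nth_mem[OF j] unfolding s
      by (auto simp: I_def nth_eq_iff_index_eq)
    moreover have "j \<le> i \<Longrightarrow> T (\<sigma> ! j) \<le> T (\<sigma> ! i)" "i \<le> j \<Longrightarrow> T (\<sigma> ! i) \<le> T (\<sigma> ! j)"
      using srt j \<open>i \<in> I\<close> by (auto simp: sorted_iff_nth_mono I_def)
    ultimately show "T (\<sigma> ! j) < T (\<sigma> ! i) \<longleftrightarrow> j < i"
      by (metis linorder_less_linear order.strict_iff_order less_imp_le not_less)
  qed
  have "(\<Sum>k\<in>K. charge (strip Z T k) k) = (\<Sum>i\<in>I. charge (strip_pts Z \<sigma> i) (\<sigma> ! i))"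
    unfolding K sum.reindex[OF inj] using strip by (auto intro: sum.cong)
  also have "\<dots> \<le> WB_sigma Z \<sigma>"
    unfolding WB_sigma_def by (rule sum_mono2) (auto simp: I_def)
  also have "\<dots> \<le> WB Z" using WB_sigma_le_WB assms(1) d s by blast
  finally show ?thesis .
qed

lemma WB_eq_sum_charge:
  assumes "finite Z"
  obtains T :: "int \<Rightarrow> nat" where "inj_on T (lines Z)"
    "WB Z = (\<Sum>k\<in>lines Z. charge (strip Z T k) k)"
proof -
  obtain \<sigma> where d: "distinct \<sigma>" and s: "set \<sigma> = lines Z" and W: "WB Z = WB_sigma Z \<sigma>"
    using WB_attained[OF assms] .
  have bij: "bij_betw ((!) \<sigma>) {..<length \<sigma>} (lines Z)" using bij_betw_nth[OF d refl s[symmetric]] .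
  define T where "T = the_inv_into {..<length \<sigma>} ((!) \<sigma>)"
  have T: "T (\<sigma> ! i) = i" if "i < length \<sigma>" for i
    unfolding T_def using that bij by (auto simp: bij_betw_def intro: the_inv_into_f_f)
  have "inj_on T (lines Z)"
    unfolding T_def using bij inj_on_the_inv_into by (metis bij_betw_def)
  moreover have "WB Z = (\<Sum>i<length \<sigma>. charge (strip Z T (\<sigma> ! i)) (\<sigma> ! i))"
    unfolding W WB_sigma_def
    by (intro sum.cong refl arg_cong2[of _ _ _ _ charge] strip_pts_eq_strip) (use T s in auto)
  then have "WB Z = (\<Sum>k\<in>lines Z. charge (strip Z T k) k)"
    using sum.reindex_bij_betw[OF bij, of "\<lambda>k. charge (strip Z T k) k"] by simp
  ultimately show ?thesis using that by blast
qed

section \<open>Finding and transferring crossings\<close>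

text \<open>Among the pairs in the height range of \<open>p\<close> and \<open>q\<close> that lie on
  the same sides as \<open>p\<close> and \<open>q\<close>, take one of smallest height gap: a point
  strictly between its ends could replace one of them and shrink the gap.\<close>

lemma crossing_between:
  assumes "p \<in> P" "q \<in> P" "snd p < snd q" "(fst p \<le> k) \<noteq> (fst q \<le> k)"
  obtains a b where "(a, b) \<in> crossings P k" "snd p \<le> snd a" "snd b \<le> snd q"
proof -
  define Q where "Q = (\<lambda>(a, b). a \<in> P \<and> b \<in> P \<and> snd p \<le> snd a \<and> snd a < snd b \<and> snd b \<le> snd q \<and>
      (fst a \<le> k) = (fst p \<le> k) \<and> (fst b \<le> k) = (fst q \<le> k))"
  obtain a b where ab: "Q (a, b)" and min: "\<And>c d. Q (c, d) \<Longrightarrow> nat (snd b - snd a) \<le> nat (snd d - snd c)"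
  proof -
    have "Q (p, q)" using assms by (auto simp: Q_def)
    then obtain z where "Q z" "\<forall>y. Q y \<longrightarrow> (\<lambda>(a, b). nat (snd b - snd a)) z \<le> (\<lambda>(a, b). nat (snd b - snd a)) y"
      using ex_has_least_nat[of Q _ "\<lambda>(a, b). nat (snd b - snd a)"] by blast
    then show ?thesis using that[of "fst z" "snd z"] by (cases z) fastforce
  qed
  have "\<not> (snd a < snd r \<and> snd r < snd b)" if "r \<in> P" for r
  proof
    assume r: "snd a < snd r \<and> snd r < snd b"
    then have "Q (a, r) \<or> Q (r, b)" using ab that assms(4) by (auto simp: Q_def)
    then show False using min[of a r] min[of r b] r by auto
  qed
  then have "(a, b) \<in> crossings P k" using ab assms(4) by (auto simp: crossings_def Q_def)
  then show ?thesis using that ab by (auto simp: Q_def)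
qed

text \<open>Since \<open>h\<close> keeps heights, the height interval of each pair of
  \<open>M\<close> contains that of a crossing of \<open>k'\<close> in \<open>P'\<close>. Pairs
  consecutive in \<open>P\<close> have non-overlapping height intervals, so different pairs receive
  different crossings.\<close>

lemma card_crossings_le_charge:
  assumes "finite P'" "M \<subseteq> crossings P k" "inj_on snd P"
    and h: "\<And>p. snd (h p) = snd p"
    and M: "\<And>p q. (p, q) \<in> M \<Longrightarrow> h p \<in> P' \<and> h q \<in> P' \<and> (fst (h p) \<le> k') \<noteq> (fst (h q) \<le> k')"
  shows "card M \<le> charge P' k'"
proof -
  have "\<forall>z\<in>M. \<exists>w. w \<in> crossings P' k' \<and> snd (fst z) \<le> snd (fst w) \<and> snd (snd w) \<le> snd (snd z)"
  proof
    fix z assume "z \<in> M"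
    obtain p q where z: "z = (p, q)" by (cases z)
    then have "h p \<in> P'" "h q \<in> P'" "snd (h p) < snd (h q)" "(fst (h p) \<le> k') \<noteq> (fst (h q) \<le> k')"
      using M \<open>z \<in> M\<close> assms(2) h by (auto simp: crossings_def)
    then obtain a b where "(a, b) \<in> crossings P' k'" "snd (h p) \<le> snd a" "snd b \<le> snd (h q)"
      by (rule crossing_between)
    then show "\<exists>w. w \<in> crossings P' k' \<and> snd (fst z) \<le> snd (fst w) \<and> snd (snd w) \<le> snd (snd z)"
      unfolding z h by (intro exI[of _ "(a, b)"]) simp
  qed
  then obtain F where F: "\<And>z. z \<in> M \<Longrightarrow> F z \<in> crossings P' k' \<and>
      snd (fst z) \<le> snd (fst (F z)) \<and> snd (snd (F z)) \<le> snd (snd z)"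
    by metis
  have "inj_on F M"
  proof (rule inj_onI)
    fix z w assume z: "z \<in> M" and w: "w \<in> M" and eq: "F z = F w"
    have "snd (fst (F z)) < snd (snd (F z))" using F[OF z] by (auto simp: crossings_def)
    \<comment> \<open>A shared crossing makes the two height intervals overlap. As both pairs are
      consecutive in \<open>P\<close>, no end of one lies strictly inside the other, so the ends
      agree.\<close>
    then have *: "snd (fst z) < snd (snd w)" "snd (fst w) < snd (snd z)"
      using F[OF z] F[OF w] eq by auto
    obtain p q p' q' where zw: "z = (p, q)" "w = (p', q')" by (cases z, cases w)
    then have "(p, q) \<in> crossings P k" "(p', q') \<in> crossings P k" using z w assms(2) by auto
    note pq = crossingsD[OF this(1)] and pq' = crossingsD[OF this(2)]
    have "snd p = snd p'" using * pq(5)[OF pq'(1)] pq'(5)[OF pq(1)] unfolding zw by simp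
    moreover have "snd q = snd q'" using * pq(5)[OF pq'(2)] pq'(5)[OF pq(2)] unfolding zw by simp
    ultimately show "z = w" using assms(3) pq(1,2) pq'(1,2) zw by (auto dest: inj_onD)
  qed
  then show ?thesis unfolding charge_eq_card
    using F finite_crossings[OF assms(1)] by (intro card_inj_on_le[of F]) auto
qed

text \<open>The condition fixes two of the independent membership choices; this is the probability
  1/4 for a uniformly random \<open>D\<close>.\<close>

lemma card_subsets_separating:
  assumes "finite V" "a \<in> V" "b \<in> V" "a \<noteq> b"
  shows "4 * card {D \<in> Pow V. a \<notin> D \<and> b \<in> D} = card (Pow V)"
proof -
  define V0 where "V0 = V - {a, b}"
  have V: "V = insert a (insert b V0)" "finite V0" "a \<notin> V0" "b \<notin> V0" using assms by (auto simp: V0_def)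
  have "{D \<in> Pow V. a \<notin> D \<and> b \<in> D} = insert b ` Pow V0"
  proof
    show "{D \<in> Pow V. a \<notin> D \<and> b \<in> D} \<subseteq> insert b ` Pow V0"
    proof
      fix D assume "D \<in> {D \<in> Pow V. a \<notin> D \<and> b \<in> D}"
      then have "D = insert b (D - {b})" "D - {b} \<in> Pow V0" by (auto simp: V0_def)
      then show "D \<in> insert b ` Pow V0" by (rule image_eqI)
    qed
  qed (use assms in \<open>auto simp: V0_def\<close>)
  moreover have "inj_on (insert b) (Pow V0)"
    using V(4) by (intro inj_onI) (metis Pow_iff insert_ident subset_iff)
  ultimately have "card {D \<in> Pow V. a \<notin> D \<and> b \<in> D} = 2 ^ card V0"
    by (simp add: card_image card_Pow V)
  moreover have "card V = Suc (Suc (card V0))" using V assms(4) by simp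
  ultimately show ?thesis using assms(1) by (simp add: card_Pow)
qed


section \<open>Merging blocks of columns\<close>

text \<open>\<open>g\<close> sends an active column to the leftmost active column of its block.\<close>

locale column_blocks =
  fixes X :: "point set" and g :: "int \<Rightarrow> int"
  assumes semi_perm: "semi_perm X"
    and g_le: "x \<in> fst ` X \<Longrightarrow> g x \<le> x"
    and g_col: "x \<in> fst ` X \<Longrightarrow> g x \<in> fst ` X"
    and g_idem: "x \<in> fst ` X \<Longrightarrow> g (g x) = g x"
    and g_mono: "\<lbrakk>x \<in> fst ` X; y \<in> fst ` X; x \<le> y\<rbrakk> \<Longrightarrow> g x \<le> g y"
begin

lemma finite_X: "finite X" and inj_snd: "inj_on snd X"
  using semi_perm by (auto simp: semi_perm_def inj_on_def)

definition block :: "int \<Rightarrow> point set" where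
  "block w = {p \<in> X. g (fst p) = w}"

definition contract :: "point \<Rightarrow> point" where
  "contract p = (g (fst p), snd p)"

definition inner :: "int \<Rightarrow> int \<Rightarrow> bool" where
  "inner k w \<longleftrightarrow> (\<exists>x\<in>fst ` X. \<exists>y\<in>fst ` X. x \<le> k \<and> k < y \<and> g x = w \<and> g y = w)"

text \<open>\<open>D\<close> is the set of blocks oriented to the left, i.e. those that stay with the points on their left
  when a line inside them is processed.\<close>

definition snap :: "int set \<Rightarrow> int \<Rightarrow> int" where
  "snap D k = (if \<exists>w. inner k w then let w = THE w. inner k w in if w \<in> D then w else w - 1 else k)"

section \<open>Blocks as intervals of columns, and where snapped lines fall\<close>

text \<open>\<open>g y\<close> is itself an active column fixed by \<open>g\<close>: were
  \<open>g y \<le> x\<close>, monotonicity would give \<open>g y \<le> g x\<close>.\<close>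

lemma less_block:
  assumes "x \<in> fst ` X" "y \<in> fst ` X" "g x < g y"
  shows "x < g y"
  using g_mono[OF g_col[OF assms(2)] assms(1)] g_idem[OF assms(2)] assms(3) by force

lemma less_of_block_less:
  assumes "x \<in> fst ` X" "y \<in> fst ` X" "g x < g y"
  shows "x < y"
  using less_block[OF assms] g_le[OF assms(2)] by simp

text \<open>Of two different blocks one lies entirely to the left of the other, so a line cannot
  have columns of both on both of its sides.\<close>

lemma inner_unique:
  assumes "inner k w" "inner k w'" shows "w = w'"
  using assms less_of_block_less unfolding inner_def
  by (metis linorder_less_linear order.strict_trans1 order_less_asym)

lemma snap_inner:
  assumes "inner k w"
  shows "snap D k = (if w \<in> D then w else w - 1)"
proof -
  have "(THE w. inner k w) = w" using assms inner_unique by (intro the_equality)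
  moreover have "\<exists>w. inner k w" using assms ..
  ultimately show ?thesis by (simp add: snap_def)
qed

lemma snap_outer: "(\<And>w. \<not> inner k w) \<Longrightarrow> snap D k = k"
  by (simp add: snap_def)

text \<open>If \<open>k\<close> runs inside a block, this is a third block \<open>w\<close> strictly
  between the two, so both \<open>w - 1\<close> and \<open>w\<close> separate \<open>g a\<close>
  from \<open>g b\<close>. Otherwise \<open>k\<close> stays in place, and it lies left of
  \<open>g b\<close> because it does not run inside the block of \<open>b\<close>.\<close>

lemma snap_separates:
  assumes ab: "a \<in> fst ` X" "b \<in> fst ` X" "g a < g b" and k: "a \<le> k" "k < b"
    and nin: "\<not> inner k (g a)" "\<not> inner k (g b)"
  shows "g a \<le> snap D k \<and> snap D k < g b"
proof (cases "\<exists>w. inner k w")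
  case True
  then obtain w where w: "inner k w" by blast
  then obtain x y where xy: "x \<in> fst ` X" "y \<in> fst ` X" "x \<le> k" "k < y" "g x = w" "g y = w"
    by (auto simp: inner_def)
  have "w \<noteq> g a" "w \<noteq> g b" using w nin by auto
  moreover have "\<not> w < g a" using less_of_block_less[of y a] xy ab k by auto
  moreover have "\<not> g b < w" using less_of_block_less[of b x] xy ab k by auto
  ultimately show ?thesis using snap_inner[OF w, of D] by auto
next
  case False
  have "k < g b"
  proof (rule ccontr)
    assume "\<not> k < g b"
    then have "inner k (g b)" unfolding inner_def
      using ab k g_col g_idem by (intro bexI[of _ "g b"] bexI[of _ b]) auto
    then show False using False by blast
  qed
  then show ?thesis using snap_outer[of k D] False g_le[OF ab(1)] k by auto
qed

text \<open>The orientations serve this purpose: a line inside the block of \<open>a\<close> snaps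
  to the left of \<open>g a\<close>, and one inside the block of \<open>b\<close> snaps to the right
  of \<open>g b\<close>.\<close>

lemma snap_not_separates:
  assumes ab: "a \<in> fst ` X" "b \<in> fst ` X" "g a < g b" and k: "\<not> (a \<le> k \<and> k < b)"
    and D: "g a \<notin> D" "g b \<in> D"
  shows "\<not> (g a \<le> snap D k \<and> snap D k < g b)"
proof (cases "\<exists>w. inner k w")
  case True
  then obtain w where w: "inner k w" by blast
  then obtain x y where xy: "x \<in> fst ` X" "y \<in> fst ` X" "x \<le> k" "k < y" "g x = w" "g y = w"
    by (auto simp: inner_def)
  \<comment> \<open>A line inside a block strictly between the two would separate \<open>a\<close>
    from \<open>b\<close>.\<close>
  have "\<not> (g a < w \<and> w < g b)"
    using less_of_block_less[of a x] less_of_block_less[of y b] xy ab k by auto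
  then consider "w < g a" | "w = g a" | "w = g b" | "g b < w" by linarith
  then show ?thesis using snap_inner[OF w, of D] D by cases (auto split: if_splits)
next
  case False
  have "inner k (g a)" if "g a \<le> k" "k < a"
    unfolding inner_def using ab that g_col g_idem by (intro bexI[of _ "g a"] bexI[of _ a]) auto
  moreover have "inner k (g b)" if "g b \<le> k" "k < b"
    unfolding inner_def using ab that g_col g_idem by (intro bexI[of _ "g b"] bexI[of _ b]) auto
  ultimately show ?thesis using snap_outer[of k D] False k g_le[OF ab(2)] by force
qed

section \<open>Links of a fixed ordering, sorted into three kinds\<close>

context
  fixes T :: "int \<Rightarrow> nat"
  assumes inj_T: "inj_on T (lines X)"
begin

definition links :: "int \<Rightarrow> (point \<times> point) set" where
  "links k = crossings (strip X T k) k"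

definition local_links :: "int \<Rightarrow> (point \<times> point) set" where
  "local_links k = {(p, q) \<in> links k. g (fst p) = g (fst q)}"

definition near_links :: "int \<Rightarrow> (point \<times> point) set" where
  "near_links k = {(p, q) \<in> links k. g (fst p) \<noteq> g (fst q) \<and> (inner k (g (fst p)) \<or> inner k (g (fst q)))}"

definition far_links :: "int \<Rightarrow> (point \<times> point) set" where
  "far_links k = {(p, q) \<in> links k. g (fst p) \<noteq> g (fst q) \<and> \<not> inner k (g (fst p)) \<and> \<not> inner k (g (fst q))}"

lemma finite_links: "finite (links k)"
  unfolding links_def by (intro finite_crossings finite_strip finite_X)

lemma linksD:
  assumes "(p, q) \<in> links k"
  shows "p \<in> X" "q \<in> X" "(fst p \<le> k) \<noteq> (fst q \<le> k)" "snd p < snd q"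
    "T j < T k \<Longrightarrow> (fst p \<le> j) = (k \<le> j)" "T j < T k \<Longrightarrow> (fst q \<le> j) = (k \<le> j)"
    "r \<in> strip X T k \<Longrightarrow> \<not> (snd p < snd r \<and> snd r < snd q)"
proof -
  note c = crossingsD[OF assms[unfolded links_def]]
  show "p \<in> X" "q \<in> X" "(fst p \<le> k) \<noteq> (fst q \<le> k)" "snd p < snd q"
    "T j < T k \<Longrightarrow> (fst p \<le> j) = (k \<le> j)" "T j < T k \<Longrightarrow> (fst q \<le> j) = (k \<le> j)"
    "r \<in> strip X T k \<Longrightarrow> \<not> (snd p < snd r \<and> snd r < snd q)"
    using c by (simp_all add: strip_def)
qed

lemma links_split: "links k = local_links k \<union> near_links k \<union> far_links k"
  by (auto simp: local_links_def near_links_def far_links_def)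

text \<open>The strip of a block is part of the strip of \<open>X\<close> for the same line and
  stamps, so the ends of a local link stay consecutive in it. The stamps restricted to the lines of
  the block form an ordering, whose cost is at most the Wilber bound of the block.\<close>

lemma sum_local_links: "(\<Sum>k\<in>lines X. card (local_links k)) \<le> (\<Sum>w\<in>g ` fst ` X. WB (block w))"
proof -
  have fin: "finite (block w)" for w using finite_X by (simp add: block_def)
  \<comment> \<open>The value 0 for lines outside the block lets both sums range over
    \<open>lines X\<close>, so that they can be exchanged.\<close>
  define c where "c k w = (if k \<in> lines (block w) then charge (strip (block w) T k) k else 0)" for k w
  have "card (local_links k) \<le> (\<Sum>w\<in>g ` fst ` X. c k w)" for k
  proof -
    define A where "A w = (if k \<in> lines (block w) then crossings (strip (block w) T k) k else {})" for w
    have finA: "finite (A w)" for w by (simp add: A_def fin finite_crossings finite_strip)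
    have "z \<in> (\<Union>w\<in>g ` fst ` X. A w)" if z: "z \<in> local_links k" for z
    proof -
      obtain p q where pq: "z = (p, q)" by (cases z)
      then have l: "(p, q) \<in> links k" and eq: "g (fst q) = g (fst p)"
        using z by (auto simp: local_links_def)
      define w where "w = g (fst p)"
      have b: "p \<in> block w" "q \<in> block w" using linksD[OF l] eq by (auto simp: block_def w_def)
      have "k \<in> lines (block w)"
        using b linksD(3)[OF l] unfolding lines_def by (cases "fst p \<le> k") force+
      moreover have "(p, q) \<in> crossings (strip (block w) T k) k"
        using b l by (auto simp: links_def crossings_def strip_def block_def)
      ultimately show ?thesis using b pq by (auto simp: A_def block_def intro!: bexI[of _ p])
    qed
    then have "card (local_links k) \<le> card (\<Union>w\<in>g ` fst ` X. A w)"
      using finite_X finA by (intro card_mono) auto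
    also have "\<dots> \<le> (\<Sum>w\<in>g ` fst ` X. card (A w))" using finite_X by (intro card_UN_le) auto
    also have "\<dots> = (\<Sum>w\<in>g ` fst ` X. c k w)"
      by (intro sum.cong) (auto simp: A_def c_def charge_eq_card)
    finally show ?thesis .
  qed
  then have "(\<Sum>k\<in>lines X. card (local_links k)) \<le> (\<Sum>k\<in>lines X. \<Sum>w\<in>g ` fst ` X. c k w)"
    by (intro sum_mono)
  also have "\<dots> = (\<Sum>w\<in>g ` fst ` X. \<Sum>k\<in>lines X. c k w)" by (rule sum.swap)
  also have "\<dots> \<le> (\<Sum>w\<in>g ` fst ` X. WB (block w))"
  proof (rule sum_mono)
    fix w
    have sub: "lines (block w) \<subseteq> lines X" by (rule lines_mono) (auto simp: block_def)
    have "(\<Sum>k\<in>lines X. c k w) = (\<Sum>k\<in>lines (block w). charge (strip (block w) T k) k)"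
      using sub finite_lines[OF finite_X]
      by (intro sum.mono_neutral_cong_right) (auto simp: c_def)
    also have "\<dots> \<le> WB (block w)"
      using inj_T sub by (intro sum_charge_le_WB fin) (auto dest: inj_onD)
    finally show "(\<Sum>k\<in>lines X. c k w) \<le> WB (block w)" .
  qed
  finally show ?thesis .
qed

section \<open>Links whose line runs inside the block of an end\<close>

text \<open>Being across \<open>k'\<close> and in another block, \<open>q'\<close> lies beyond the
  whole block of \<open>p\<close> on that side, hence beyond \<open>k\<close> as well. So
  \<open>k\<close> separates \<open>p\<close> from \<open>q'\<close>, and they cannot share a strip
  after \<open>k\<close>.\<close>

lemma cut_off_once:
  assumes X: "p \<in> X" "q' \<in> X"
    and inn: "inner k (g (fst p))" and out: "g (fst q') \<noteq> g (fst p)"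
    and side: "(fst p \<le> k) = (fst p \<le> k')" and cross: "(fst p \<le> k') \<noteq> (fst q' \<le> k')"
    and T: "T k < T k' \<Longrightarrow> (fst p \<le> k) = (fst q' \<le> k)"
  shows "\<not> T k < T k'"
proof
  assume "T k < T k'"
  note T = T[OF this]
  obtain x y where xy: "x \<in> fst ` X" "y \<in> fst ` X" "x \<le> k" "k < y" "g x = g (fst p)" "g y = g (fst p)"
    using inn by (auto simp: inner_def)
  have X': "fst p \<in> fst ` X" "fst q' \<in> fst ` X" using X by auto
  show False
  proof (cases "fst p \<le> k")
    case True
    then have "g (fst p) < g (fst q')" using g_mono[OF X'] out cross side by auto
    then show False using less_of_block_less[OF xy(2) X'(2)] xy True T by auto
  next
    case False
    then have "g (fst q') < g (fst p)" using g_mono[OF X'(2,1)] out cross side by auto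
    then show False using less_of_block_less[OF X'(2) xy(1)] xy False T by auto
  qed
qed

text \<open>Charge a near link to an end whose block contains the line, together with the side of
  the line on which this end lies. By \<open>cut_off_once\<close> such a charge occurs at most once
  for lower ends and at most once for upper ends; with two sides each, this gives the factor
  4.\<close>

lemma sum_near_links: "(\<Sum>k\<in>lines X. card (near_links k)) \<le> 4 * card X"
proof -
  define N where "N = Sigma (lines X) near_links"
  define N1 where "N1 = {(k, p, q) \<in> N. inner k (g (fst p))}"
  define N2 where "N2 = {(k, p, q) \<in> N. inner k (g (fst q))}"
  have card_XB: "card (X \<times> (UNIV :: bool set)) = 2 * card X" by (simp add: card_cartesian_product)
  have finXB: "finite (X \<times> (UNIV :: bool set))" using finite_X by simp
  have N: "k \<in> lines X" "(p, q) \<in> links k" "g (fst p) \<noteq> g (fst q)" if "(k, p, q) \<in> N" for k p q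
    using that by (auto simp: N_def near_links_def)
  have "inj_on (\<lambda>(k, p, q). (p, fst p \<le> k)) N1"
  proof (rule inj_onI)
    fix z z'
    assume z: "z \<in> N1" "z' \<in> N1" and eq: "(\<lambda>(k, p, q). (p, fst p \<le> k)) z = (\<lambda>(k, p, q). (p, fst p \<le> k)) z'"
    obtain k p q k' p' q' where zz: "z = (k, p, q)" "z' = (k', p', q')" by (metis prod_cases3)
    have 1: "(k, p, q) \<in> N1" and 2: "(k', p', q') \<in> N1" and p: "p = p'"
      and s: "(fst p \<le> k) = (fst p' \<le> k')"
      using z eq zz by auto
    have n: "(k, p, q) \<in> N" "(k', p, q') \<in> N" "inner k (g (fst p))" "inner k' (g (fst p))"
      using 1 2 p by (auto simp: N1_def)
    note l = linksD[OF N(2)[OF n(1)]] linksD[OF N(2)[OF n(2)]]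
    have "\<not> T k < T k'"
      by (rule cut_off_once[of p q']) (use l n N(3)[OF n(2)] s p in auto)
    moreover have "\<not> T k' < T k"
      by (rule cut_off_once[of p q]) (use l n N(3)[OF n(1)] s p in auto)
    ultimately have k: "k = k'" using inj_T N(1)[OF n(1)] N(1)[OF n(2)] by (auto dest: inj_onD)
    \<comment> \<open>With the line and the lower end fixed, the upper end is the next point of the
      strip and hence determined.\<close>
    have "q \<in> strip X T k" "q' \<in> strip X T k"
      using N(2)[OF n(1)] N(2)[OF n(2)] k by (auto simp: links_def crossings_def)
    then have "snd q = snd q'" using l(7)[of q'] l(14)[of q] l(4) l(11) k by force
    then have "q = q'" using inj_onD[OF inj_snd] l by blast
    then show "z = z'" using k p zz by simp
  qed
  then have 1: "card N1 \<le> 2 * card X" unfolding card_XB[symmetric]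
    by (rule card_inj_on_le) (use finXB linksD(1)[OF N(2)] in \<open>auto simp: N1_def\<close>)
  have "inj_on (\<lambda>(k, p, q). (q, fst q \<le> k)) N2"
  proof (rule inj_onI)
    fix z z'
    assume z: "z \<in> N2" "z' \<in> N2" and eq: "(\<lambda>(k, p, q). (q, fst q \<le> k)) z = (\<lambda>(k, p, q). (q, fst q \<le> k)) z'"
    obtain k p q k' p' q' where zz: "z = (k, p, q)" "z' = (k', p', q')" by (metis prod_cases3)
    have 1: "(k, p, q) \<in> N2" and 2: "(k', p', q') \<in> N2" and q: "q = q'"
      and s: "(fst q \<le> k) = (fst q' \<le> k')"
      using z eq zz by auto
    have n: "(k, p, q) \<in> N" "(k', p', q) \<in> N" "inner k (g (fst q))" "inner k' (g (fst q))"
      using 1 2 q by (auto simp: N2_def)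
    note l = linksD[OF N(2)[OF n(1)]] linksD[OF N(2)[OF n(2)]]
    have "\<not> T k < T k'"
      by (rule cut_off_once[of q p']) (use l n N(3)[OF n(2)] s q in auto)
    moreover have "\<not> T k' < T k"
      by (rule cut_off_once[of q p]) (use l n N(3)[OF n(1)] s q in auto)
    ultimately have k: "k = k'" using inj_T N(1)[OF n(1)] N(1)[OF n(2)] by (auto dest: inj_onD)
    have "p \<in> strip X T k" "p' \<in> strip X T k"
      using N(2)[OF n(1)] N(2)[OF n(2)] k by (auto simp: links_def crossings_def)
    then have "snd p = snd p'" using l(7)[of p'] l(14)[of p] l(4) l(11) k by force
    then have "p = p'" using inj_onD[OF inj_snd] l by blast
    then show "z = z'" using k q zz by simp
  qed
  then have 2: "card N2 \<le> 2 * card X" unfolding card_XB[symmetric]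
    by (rule card_inj_on_le) (use finXB linksD(2)[OF N(2)] in \<open>auto simp: N2_def\<close>)
  have finN: "finite (near_links k)" for k
    by (rule finite_subset[OF _ finite_links]) (auto simp: near_links_def)
  have "(\<Sum>k\<in>lines X. card (near_links k)) = card N"
    unfolding N_def using finite_lines[OF finite_X] finN by (intro card_SigmaI[symmetric]) auto
  also have "\<dots> = card (N1 \<union> N2)"
    by (rule arg_cong[of _ _ card]) (auto simp: N1_def N2_def N_def near_links_def)
  also have "\<dots> \<le> 4 * card X" using card_Un_le[of N1 N2] 1 2 by linarith
  finally show ?thesis .
qed

section \<open>Remaining links under a random orientation\<close>

text \<open>Far links whose survival under \<open>D\<close> is guaranteed. The case distinction
  finds the left end, because a link is ordered by height.\<close>

definition kept_links :: "int set \<Rightarrow> int \<Rightarrow> (point \<times> point) set" where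
  "kept_links D k = {(p, q) \<in> far_links k.
     if fst p \<le> k then g (fst p) \<notin> D \<and> g (fst q) \<in> D else g (fst q) \<notin> D \<and> g (fst p) \<in> D}"

text \<open>Lines hit by no \<open>snap D k\<close> get the default stamp, later than all others; ties among them are
  harmless because such lines are not counted.\<close>

definition snap_time :: "int set \<Rightarrow> int \<Rightarrow> nat" where
  "snap_time D j = (LEAST n. n = Suc (Max (T ` lines X)) \<or> (\<exists>k\<in>lines X. snap D k = j \<and> T k = n))"

text \<open>Stamps up to \<open>T k\<close> are below the default value, so they come from the
  earliest line of \<open>X\<close> that snaps to \<open>j\<close>.\<close>

lemma snap_time_less:
  assumes "k \<in> lines X" "snap_time D j \<le> T k"
  obtains i where "i \<in> lines X" "snap D i = j" "T i = snap_time D j"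
proof -
  have "T k \<le> Max (T ` lines X)" using assms(1) finite_lines[OF finite_X] by auto
  moreover have "snap_time D j = Suc (Max (T ` lines X)) \<or>
      (\<exists>k\<in>lines X. snap D k = j \<and> T k = snap_time D j)"
    unfolding snap_time_def by (rule LeastI2_wellorder) auto
  ultimately show ?thesis using that assms(2) by auto
qed

lemma snap_time_le: "k \<in> lines X \<Longrightarrow> snap_time D (snap D k) \<le> T k"
  unfolding snap_time_def by (rule Least_le) auto

text \<open>The snap of \<open>k\<close> separates the contracted ends while the snap of no earlier
  line does, so the contracted ends are still together when \<open>snap D k\<close> is
  processed.\<close>

lemma kept_link_survives:
  assumes k: "k \<in> lines X" and pq: "(p, q) \<in> kept_links D k"
  shows "contract p \<in> strip (contract ` X) (snap_time D) (snap D k)"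
    "contract q \<in> strip (contract ` X) (snap_time D) (snap D k)"
    "(fst (contract p) \<le> snap D k) \<noteq> (fst (contract q) \<le> snap D k)"
    "snap_time D (snap D k) = T k"
proof -
  have far: "(p, q) \<in> far_links k" using pq by (simp add: kept_links_def)
  then have l: "(p, q) \<in> links k" by (simp add: far_links_def)
  note l = linksD[OF l]
  obtain a b where ab: "a = p \<and> b = q \<or> a = q \<and> b = p" and le: "fst a \<le> k" "k < fst b"
    and D: "g (fst a) \<notin> D" "g (fst b) \<in> D"
  proof (cases "fst p \<le> k")
    case True
    then show ?thesis using that[of p q] pq l(3) by (auto simp: kept_links_def)
  next
    case False
    then show ?thesis using that[of q p] pq l(3) by (auto simp: kept_links_def)
  qed
  have X: "a \<in> X" "b \<in> X" using ab l(1,2) by auto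
  then have X': "fst a \<in> fst ` X" "fst b \<in> fst ` X" by auto
  have nin: "\<not> inner k (g (fst a))" "\<not> inner k (g (fst b))" using ab far by (auto simp: far_links_def)
  have "g (fst a) \<noteq> g (fst b)" using D by auto
  then have less: "g (fst a) < g (fst b)" using g_mono[OF X'] le by auto
  have sep: "g (fst a) \<le> snap D k" "snap D k < g (fst b)"
    using snap_separates[OF X' less le nin] by auto
  have early: "\<not> (g (fst a) \<le> snap D j \<and> snap D j < g (fst b))" if "T j < T k" for j
  proof (rule snap_not_separates[OF X' less _ D])
    show "\<not> (fst a \<le> j \<and> j < fst b)" using l(5,6)[OF that] ab by auto
  qed
  \<comment> \<open>An earlier line with the same snap would already separate the contracted
    ends.\<close>
  show time: "snap_time D (snap D k) = T k"
  proof (rule antisym[OF snap_time_le[OF k]])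
    obtain i where "snap D i = snap D k" "T i = snap_time D (snap D k)"
      using snap_time_less[OF k snap_time_le[OF k]] by metis
    then show "T k \<le> snap_time D (snap D k)" using early[of i] sep by force
  qed
  \<comment> \<open>An earlier \<open>j\<close> is the snap of an earlier line, so both contracted
    ends lie on one side of it, and so does \<open>snap D k\<close>, which runs between
    them.\<close>
  have "(g (fst a) \<le> j) = (snap D k \<le> j) \<and> (g (fst b) \<le> j) = (snap D k \<le> j)"
    if "snap_time D j < snap_time D (snap D k)" for j
  proof -
    have "snap_time D j \<le> T k" using that time by simp
    then obtain i where "snap D i = j" "T i = snap_time D j"
      using snap_time_less[OF k] by blast
    then show ?thesis using early[of i] sep that time by auto
  qed
  then have "contract a \<in> strip (contract ` X) (snap_time D) (snap D k)"
    "contract b \<in> strip (contract ` X) (snap_time D) (snap D k)"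
    using X by (auto simp: strip_def contract_def)
  then show "contract p \<in> strip (contract ` X) (snap_time D) (snap D k)"
    "contract q \<in> strip (contract ` X) (snap_time D) (snap D k)"
    using ab by auto
  show "(fst (contract p) \<le> snap D k) \<noteq> (fst (contract q) \<le> snap D k)"
    using ab sep by (auto simp: contract_def)
qed

text \<open>Contraction keeps heights, so the kept links of a line number at most the charge of its
  snap. Lines with kept links have different snaps, so these charges belong to a single
  ordering.\<close>

lemma sum_kept_links: "(\<Sum>k\<in>lines X. card (kept_links D k)) \<le> WB (contract ` X)"
proof -
  define L where "L = {k \<in> lines X. kept_links D k \<noteq> {}}"
  have surv: "snap_time D (snap D k) = T k" "snap D k \<in> lines (contract ` X)" if kL: "k \<in> L" for k
  proof -
    obtain p q where pq: "(p, q) \<in> kept_links D k" and k: "k \<in> lines X" using kL by (auto simp: L_def)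
    note s = kept_link_survives[OF k pq]
    show "snap_time D (snap D k) = T k" by fact
    have "contract p \<in> contract ` X" "contract q \<in> contract ` X" using s by (auto simp: strip_def)
    then show "snap D k \<in> lines (contract ` X)"
      using s(3) unfolding lines_def by (cases "fst (contract p) \<le> snap D k") force+
  qed
  \<comment> \<open>The stamp of the snap gives back \<open>T k\<close>, and \<open>T\<close> is
    injective.\<close>
  have inj: "inj_on (snap D) L"
    using surv(1) inj_T by (intro inj_onI) (metis (lifting) L_def inj_onD mem_Collect_eq)
  have "(\<Sum>k\<in>lines X. card (kept_links D k)) = (\<Sum>k\<in>L. card (kept_links D k))"
    using finite_lines[OF finite_X] by (intro sum.mono_neutral_right) (auto simp: L_def)
  also have "\<dots> \<le> (\<Sum>k\<in>L. charge (strip (contract ` X) (snap_time D) (snap D k)) (snap D k))"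
  proof (rule sum_mono)
    fix k assume "k \<in> L"
    then have k: "k \<in> lines X" by (simp add: L_def)
    show "card (kept_links D k) \<le> charge (strip (contract ` X) (snap_time D) (snap D k)) (snap D k)"
    proof (rule card_crossings_le_charge[where h = contract])
      show "finite (strip (contract ` X) (snap_time D) (snap D k))" using finite_X by (simp add: finite_strip)
      show "kept_links D k \<subseteq> crossings (strip X T k) k"
        by (auto simp: kept_links_def far_links_def links_def)
      show "inj_on snd (strip X T k)" using inj_snd by (auto simp: strip_def intro: inj_on_subset)
    qed (use kept_link_survives[OF k] in \<open>auto simp: contract_def\<close>)
  qed
  also have "\<dots> = (\<Sum>j\<in>snap D ` L. charge (strip (contract ` X) (snap_time D) j) j)"
    by (simp add: sum.reindex[OF inj])
  also have "\<dots> \<le> WB (contract ` X)"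
  proof (rule sum_charge_le_WB)
    show "finite (contract ` X)" using finite_X by simp
    show "snap D ` L \<subseteq> lines (contract ` X)" using surv by auto
    \<comment> \<open>A line with the stamp of a counted one is the snap of some \<open>k'\<close>
      with \<open>T k' = T k\<close>, hence the same line.\<close>
    fix j i assume "i \<in> snap D ` L" and eq: "snap_time D j = snap_time D i"
    then obtain k where k: "k \<in> L" "i = snap D k" by blast
    then have kX: "k \<in> lines X" by (simp add: L_def)
    obtain k' where "k' \<in> lines X" "snap D k' = j" "T k' = snap_time D j"
      using snap_time_less[OF kX, of D j] eq k surv(1) by auto
    then show "j = i" using eq k surv(1)[OF k(1)] kX inj_T by (metis inj_onD)
  qed
  finally show ?thesis .
qed

text \<open>Average over all sets \<open>D\<close> of blocks: each far link is kept by exactly a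
  quarter of them, and the links kept by a single \<open>D\<close> are bounded by the Wilber bound
  of the contracted instance.\<close>

lemma sum_far_links: "(\<Sum>k\<in>lines X. card (far_links k)) \<le> 4 * WB (contract ` X)"
proof -
  define V where "V = g ` fst ` X"
  have finV: "finite V" using finite_X by (simp add: V_def)
  have finF: "finite (far_links k)" for k
    by (rule finite_subset[OF _ finite_links]) (auto simp: far_links_def)
  define good where "good k z D \<longleftrightarrow> z \<in> kept_links D k" for k z D
  have quarter: "4 * card {D \<in> Pow V. good k z D} = card (Pow V)" if z: "z \<in> far_links k" for k z
  proof -
    obtain p q where pq: "z = (p, q)" by (cases z)
    then have l: "(p, q) \<in> links k" and ne: "g (fst p) \<noteq> g (fst q)" using z by (auto simp: far_links_def)
    have "g (fst p) \<in> V" "g (fst q) \<in> V" using linksD(1,2)[OF l] by (auto simp: V_def)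
    then show ?thesis
      using card_subsets_separating[OF finV, of "g (fst p)" "g (fst q)"]
        card_subsets_separating[OF finV, of "g (fst q)" "g (fst p)"] ne z pq
      by (cases "fst p \<le> k") (auto simp: good_def kept_links_def)
  qed
  \<comment> \<open>Double counting of the pairs of an orientation and a link that it keeps.\<close>
  have count: "card (Pow V) * card (far_links k) = 4 * (\<Sum>D\<in>Pow V. card (kept_links D k))" for k
  proof -
    have "(\<Sum>D\<in>Pow V. card (kept_links D k)) = (\<Sum>D\<in>Pow V. card {z \<in> far_links k. good k z D})"
      by (intro sum.cong refl arg_cong[of _ _ card]) (auto simp: good_def kept_links_def)
    also have "\<dots> = (\<Sum>z\<in>far_links k. card {D \<in> Pow V. good k z D})"
      using sum.swap_restrict[of "Pow V" "far_links k" "\<lambda>_ _. 1::nat" "\<lambda>D z. good k z D"] finV finF by simp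
    finally have "4 * (\<Sum>D\<in>Pow V. card (kept_links D k)) = (\<Sum>z\<in>far_links k. 4 * card {D \<in> Pow V. good k z D})"
      by (simp add: sum_distrib_left)
    also have "\<dots> = card (far_links k) * card (Pow V)" using quarter by simp
    finally show ?thesis by simp
  qed
  have "card (Pow V) * (\<Sum>k\<in>lines X. card (far_links k)) =
      (\<Sum>D\<in>Pow V. 4 * (\<Sum>k\<in>lines X. card (kept_links D k)))"
    unfolding sum_distrib_left count by (subst sum.swap) simp
  also have "\<dots> \<le> (\<Sum>D\<in>Pow V. 4 * WB (contract ` X))"
    by (intro mult_le_mono2 sum_mono sum_kept_links)
  also have "\<dots> = card (Pow V) * (4 * WB (contract ` X))" by simp
  finally show ?thesis using finV by (simp add: card_Pow)
qed

lemma sum_links: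
  "(\<Sum>k\<in>lines X. card (links k)) \<le>
     4 * WB (contract ` X) + (\<Sum>w\<in>g ` fst ` X. WB (block w)) + 4 * card X"
proof -
  have "card (links k) \<le> card (local_links k) + card (near_links k) + card (far_links k)" for k
    unfolding links_split by (meson add_mono card_Un_le order_refl order_trans)
  then have "(\<Sum>k\<in>lines X. card (links k)) \<le>
      (\<Sum>k\<in>lines X. card (local_links k) + card (near_links k) + card (far_links k))"
    by (intro sum_mono)
  then show ?thesis
    using sum_local_links sum_near_links sum_far_links by (simp add: sum.distrib)
qed

end

text \<open>For the stamps of an optimal ordering, the number of links is
  \<open>WB X\<close>.\<close>

lemma WB_le_contract:
  "WB X \<le> 4 * WB (contract ` X) + (\<Sum>w\<in>g ` fst ` X. WB (block w)) + 4 * card X"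
proof -
  obtain T :: "int \<Rightarrow> nat" where T: "inj_on T (lines X)"
    and W: "WB X = (\<Sum>k\<in>lines X. charge (strip X T k) k)"
    using WB_eq_sum_charge[OF finite_X] .
  show ?thesis using sum_links[OF T] unfolding W links_def[OF T] charge_eq_card .
qed

end

section \<open>Strips of a partitioning tree\<close>

lemma position_extends_to_leaf: "v \<in> positions t \<Longrightarrow> \<exists>s. v @ s \<in> leaf_positions t"
proof (induction t arbitrary: v)
  case (Node k l r)
  show ?case
  proof (cases v)
    case Nil
    have "[] \<in> positions l" by (cases l) auto
    then obtain s where "s \<in> leaf_positions l" using Node.IH(1) by fastforce
    then show ?thesis using Nil by (intro exI[of _ "False # s"]) simp
  next
    case (Cons b u)
    then have "u \<in> positions (if b then r else l)" using Node.prems by (cases b) auto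
    then obtain s where "u @ s \<in> leaf_positions (if b then r else l)"
      using Node.IH by (cases b) fastforce+
    then show ?thesis using Cons by (intro exI[of _ s]) (cases b, auto)
  qed
qed simp

text \<open>Both vertices lie on a common root-to-leaf path, which meets \<open>U\<close> only
  once.\<close>

lemma cut_set_antichain:
  assumes "cut_set T U" "v \<in> U" "v @ s \<in> U"
  shows "s = []"
proof -
  have "v @ s \<in> positions T" using assms by (auto simp: cut_set_def)
  then obtain u where u: "v @ s @ u \<in> leaf_positions T" using position_extends_to_leaf by fastforce
  have "\<exists>!i. i \<le> length (v @ s @ u) \<and> take i (v @ s @ u) \<in> U"
    using assms(1) u unfolding cut_set_def by blast
  moreover have "take (length v) (v @ s @ u) \<in> U" "take (length (v @ s)) (v @ s @ u) \<in> U"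
    using assms(2,3) by simp_all
  ultimately have "length v = length (v @ s)" by (metis append.assoc le_add1 length_append)
  then show ?thesis by simp
qed

lemma strip_of_subset:
  assumes "wf_ptree X lo hi t" "v \<in> positions t" "strip_of t lo hi v = (c, d)"
  shows "lo \<le> c \<and> d \<le> hi"
  using assms
proof (induction t arbitrary: lo hi v)
  case (Node k l r)
  show ?case
  proof (cases v)
    case (Cons b u)
    then show ?thesis using Node.prems Node.IH(1)[of lo k u] Node.IH(2)[of "k + 1" hi u]
      by (cases b) auto
  qed (use Node.prems in auto)
qed simp

text \<open>Incomparable vertices part at some node with line \<open>k\<close>: one strip ends at
  \<open>k\<close> or before, the other starts at \<open>k + 1\<close> or later.\<close>

lemma strip_of_disjoint:
  assumes "wf_ptree X lo hi t" "v \<in> positions t" "w \<in> positions t"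
    "strip_of t lo hi v = (c, d)" "strip_of t lo hi w = (c', d')"
  shows "(\<exists>s. w = v @ s) \<or> (\<exists>s. v = w @ s) \<or> d < c' \<or> d' < c"
  using assms
proof (induction t arbitrary: lo hi v w)
  case (Node k l r)
  have wf: "wf_ptree X lo k l" "wf_ptree X (k + 1) hi r" using Node.prems by auto
  show ?case
  proof (cases "v = [] \<or> w = []")
    case False
    then obtain a v' b w' where vw: "v = a # v'" "w = b # w'" by (metis list.exhaust)
    show ?thesis
    proof (cases a; cases b)
      assume "\<not> a" "\<not> b"
      then show ?thesis using Node.IH(1)[OF wf(1), of v' w'] Node.prems vw by auto
    next
      assume "a" "b"
      then show ?thesis using Node.IH(2)[OF wf(2), of v' w'] Node.prems vw by auto
    next
      assume "\<not> a" "b"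
      then show ?thesis
        using strip_of_subset[OF wf(1), of v' c d] strip_of_subset[OF wf(2), of w' c' d'] Node.prems vw
        by auto
    next
      assume "a" "\<not> b"
      then show ?thesis
        using strip_of_subset[OF wf(2), of v' c d] strip_of_subset[OF wf(1), of w' c' d'] Node.prems vw
        by auto
    qed
  qed auto
qed simp

text \<open>The strip contains the strip of a leaf, which has an active column.\<close>

lemma wf_ptree_nonempty:
  "wf_ptree X lo hi t \<Longrightarrow> \<exists>p\<in>X. lo \<le> fst p \<and> fst p \<le> hi"
proof (induction t arbitrary: lo hi)
  case Leaf
  then have "active_cols X lo hi \<noteq> {}" by auto
  then show ?case by (auto simp: active_cols_def)
next
  case (Node k l r)
  then have "\<exists>p\<in>X. lo \<le> fst p \<and> fst p \<le> k" "k < hi" by auto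
  then show ?case by force
qed

lemma strip_of_nonempty:
  assumes "wf_ptree X lo hi t" "v \<in> positions t" "strip_of t lo hi v = (c, d)"
  shows "\<exists>p\<in>X. c \<le> fst p \<and> fst p \<le> d"
  using assms
proof (induction t arbitrary: lo hi v)
  case Leaf
  then show ?case using wf_ptree_nonempty[OF Leaf(1)] by auto
next
  case (Node k l r)
  show ?case
  proof (cases v)
    case Nil
    then show ?thesis using wf_ptree_nonempty[OF Node.prems(1)] Node.prems(3) by auto
  next
    case (Cons b u)
    then show ?thesis using Node.prems Node.IH(1)[of lo k u] Node.IH(2)[of "k + 1" hi u]
      by (cases b) auto
  qed
qed

text \<open>Descend towards \<open>x\<close> at every line. Since the path meets \<open>U\<close>,
  this shows that the strips of \<open>U\<close> cover \<open>X\<close>.\<close>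

lemma leaf_path_to_column:
  assumes "lo \<le> x" "x \<le> hi"
  shows "\<exists>u\<in>leaf_positions t. \<forall>i c d. strip_of t lo hi (take i u) = (c, d) \<longrightarrow> c \<le> x \<and> x \<le> d"
  using assms
proof (induction t arbitrary: lo hi)
  case (Node k l r)
  show ?case
  proof (cases "x \<le> k")
    case True
    then obtain u where u: "u \<in> leaf_positions l"
      "\<forall>i c d. strip_of l lo k (take i u) = (c, d) \<longrightarrow> c \<le> x \<and> x \<le> d"
      using Node.IH(1)[of lo k] Node.prems by auto
    have "strip_of (Node k l r) lo hi (take i (False # u)) = (c, d) \<longrightarrow> c \<le> x \<and> x \<le> d" for i c d
      using u Node.prems by (cases i) auto
    then show ?thesis using u(1) by (intro bexI[of _ "False # u"]) auto
  next
    case False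
    then obtain u where u: "u \<in> leaf_positions r"
      "\<forall>i c d. strip_of r (k + 1) hi (take i u) = (c, d) \<longrightarrow> c \<le> x \<and> x \<le> d"
      using Node.IH(2)[of "k + 1" hi] Node.prems by auto
    have "strip_of (Node k l r) lo hi (take i (True # u)) = (c, d) \<longrightarrow> c \<le> x \<and> x \<le> d" for i c d
      using u Node.prems by (cases i) auto
    then show ?thesis using u(1) by (intro bexI[of _ "True # u"]) auto
  qed
qed auto

section \<open>The split as an instance of merged blocks\<close>

text \<open>The blocks are the sets \<open>split_s X T v\<close> for \<open>v \<in> U\<close>, and
  \<open>g\<close> sends a column to the leftmost one of its block; then contraction yields exactly
  \<open>split_c X T U\<close>.\<close>

lemma WB_le_split:
  assumes X: "semi_perm X" and T: "partitioning_tree X T" and U: "cut_set T U"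
  shows "WB X \<le> 4 * WB (split_c X T U) + (\<Sum>v\<in>U. WB (split_s X T v)) + 4 * card X"
proof -
  define S where "S = split_s X T"
  define m where "m v = Min (fst ` S v)" for v
  define lo where "lo = Min (fst ` X)"
  define hi where "hi = Max (fst ` X)"
  have fin: "finite X" using X by (simp add: semi_perm_def)
  have wf: "wf_ptree X lo hi T" using T by (simp add: partitioning_tree_def lo_def hi_def)
  have UT: "U \<subseteq> positions T" using U by (simp add: cut_set_def)
  have S_iff: "p \<in> S v \<longleftrightarrow> p \<in> X \<and> c \<le> fst p \<and> fst p \<le> d"
    if "strip_of T lo hi v = (c, d)" for v c d p
    using that by (auto simp: S_def split_s_def vstrip_def lo_def hi_def)
  have finS: "finite (S v)" and SX: "S v \<subseteq> X" for v
    using fin by (auto simp: S_def split_s_def)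
  have ne: "S v \<noteq> {}" if "v \<in> U" for v
  proof -
    obtain c d where s: "strip_of T lo hi v = (c, d)" by fastforce
    then show ?thesis using strip_of_nonempty[OF wf _ s] that UT S_iff[OF s] by blast
  qed
  have sep: "(\<forall>p\<in>S v. \<forall>q\<in>S w. fst p < fst q) \<or> (\<forall>p\<in>S v. \<forall>q\<in>S w. fst q < fst p)"
    if "v \<in> U" "w \<in> U" "v \<noteq> w" for v w
  proof -
    obtain c d c' d' where s: "strip_of T lo hi v = (c, d)" "strip_of T lo hi w = (c', d')" by fastforce
    \<comment> \<open>Neither vertex is an ancestor of the other, so only the disjoint cases
      remain.\<close>
    have "d < c' \<or> d' < c"
      using strip_of_disjoint[OF wf _ _ s] that UT cut_set_antichain[OF U, of v] cut_set_antichain[OF U, of w]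
      by auto
    then show ?thesis using S_iff[OF s(1)] S_iff[OF s(2)] by fastforce
  qed
  have cover: "\<exists>v\<in>U. p \<in> S v" if "p \<in> X" for p
  proof -
    have "lo \<le> fst p" "fst p \<le> hi" using that fin by (auto simp: lo_def hi_def)
    then obtain u where u: "u \<in> leaf_positions T"
      "\<forall>i c d. strip_of T lo hi (take i u) = (c, d) \<longrightarrow> c \<le> fst p \<and> fst p \<le> d"
      using leaf_path_to_column by blast
    then obtain i where i: "take i u \<in> U" using U unfolding cut_set_def by blast
    obtain c d where "strip_of T lo hi (take i u) = (c, d)" by fastforce
    then show ?thesis using i u(2) S_iff that by blast
  qed
  have m_in: "m v \<in> fst ` S v" if "v \<in> U" for v
    unfolding m_def using ne[OF that] finS by (intro Min_in) auto
  have m_le: "m v \<le> fst p" if "p \<in> S v" for v p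
    unfolding m_def using that finS by (intro Min_le) auto
  have uniq: "v = w" if "v \<in> U" "w \<in> U" "p \<in> S v" "q \<in> S w" "fst p = fst q" for v w p q
    using sep[OF that(1,2)] that(3-) by fastforce
  \<comment> \<open>The choice is unambiguous on active columns, as different strips share none;
    elsewhere \<open>g\<close> is arbitrary.\<close>
  define g where "g x = m (SOME v. v \<in> U \<and> x \<in> fst ` S v)" for x
  have g: "g (fst p) = m v" if "v \<in> U" "p \<in> S v" for v p
  proof -
    have "(SOME v. v \<in> U \<and> fst p \<in> fst ` S v) = v"
    proof (rule some_equality)
      show "v \<in> U \<and> fst p \<in> fst ` S v" using that by simp
      fix w assume "w \<in> U \<and> fst p \<in> fst ` S w"
      then show "w = v" using uniq[OF _ that(1) _ that(2)] by fastforce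
    qed
    then show ?thesis by (simp add: g_def)
  qed
  have g_m: "g (m v) = m v" if "v \<in> U" for v using m_in[OF that] g[OF that] by force
  \<comment> \<open>Different vertices have different leftmost columns, so a sum over blocks is a
    sum over \<open>U\<close>.\<close>
  have inj_m: "inj_on m U"
  proof (rule inj_onI)
    fix v w assume vw: "v \<in> U" "w \<in> U" "m v = m w"
    then show "v = w" using m_in[OF vw(1)] m_in[OF vw(2)] uniq[OF vw(1,2)] by auto
  qed
  interpret column_blocks X g
  proof
    show "semi_perm X" by fact
    fix x assume "x \<in> fst ` X"
    then obtain p v where p: "x = fst p" "p \<in> S v" "v \<in> U" using cover by blast
    then show "g x \<le> x" "g x \<in> fst ` X" "g (g x) = g x"
      using g[OF p(3,2)] m_le[OF p(2)] m_in[OF p(3)] SX g_m by auto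
  next
    fix x y assume x: "x \<in> fst ` X" and y: "y \<in> fst ` X" and le: "x \<le> y"
    obtain p v where p: "x = fst p" "p \<in> S v" "v \<in> U" using cover x by blast
    obtain q w where q: "y = fst q" "q \<in> S w" "w \<in> U" using cover y by blast
    have "m v \<le> m w"
    proof (cases "v = w")
      case False
      then have "\<forall>p\<in>S v. \<forall>q\<in>S w. fst p < fst q" using sep[OF p(3) q(3)] p q le by force
      then show ?thesis using m_in[OF p(3)] m_in[OF q(3)] by force
    qed simp
    then show "g x \<le> g y" using g p q by simp
  qed
  have block: "block (m v) = S v" if "v \<in> U" for v
  proof
    show "S v \<subseteq> block (m v)" using g[OF that] SX by (auto simp: block_def)
    show "block (m v) \<subseteq> S v"
    proof
      fix p assume "p \<in> block (m v)"
      then have p: "p \<in> X" "g (fst p) = m v" by (auto simp: block_def)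
      then obtain w where w: "w \<in> U" "p \<in> S w" using cover by blast
      then have "w = v" using g[OF w] p(2) inj_m that by (auto dest: inj_onD)
      then show "p \<in> S v" using w by simp
    qed
  qed
  have "contract ` X = split_c X T U"
  proof -
    have "X = (\<Union>v\<in>U. S v)" using cover SX by blast
    then have "contract ` X = (\<Union>v\<in>U. contract ` S v)" by (metis image_UN)
    also have "\<dots> = (\<Union>v\<in>U. (\<lambda>p. (m v, snd p)) ` S v)"
      using g by (intro SUP_cong refl image_cong) (auto simp: contract_def)
    finally show ?thesis by (simp add: split_c_def S_def m_def)
  qed
  moreover have "g ` fst ` X = m ` U"
  proof
    show "g ` fst ` X \<subseteq> m ` U" using cover g by force
    show "m ` U \<subseteq> g ` fst ` X" using g_m m_in SX by force
  qed
  then have "(\<Sum>w\<in>g ` fst ` X. WB (block w)) = (\<Sum>v\<in>U. WB (S v))"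
    using block by (simp add: sum.reindex[OF inj_m])
  ultimately show ?thesis using WB_le_contract by (simp add: S_def)
qed

theorem theorem3p4:
  shows "\<exists>c::real. \<forall>X T U. semi_perm X \<and> partitioning_tree X T \<and> cut_set T U \<longrightarrow>
     real (WB X) \<le> 4 * real (WB (split_c X T U))
        + 8 * (\<Sum>v\<in>U. real (WB (split_s X T v))) + c * real (card X)"
\<comment> \<open>The constant 4 comes from the near links: two ends and two sides for every
  point.\<close>
proof (intro exI[of _ 4] allI impI, elim conjE)
  fix X T U assume "semi_perm X" "partitioning_tree X T" "cut_set T U"
  then have "real (WB X) \<le> real (4 * WB (split_c X T U) + (\<Sum>v\<in>U. WB (split_s X T v)) + 4 * card X)"
    by (intro of_nat_mono WB_le_split)
  \<comment> \<open>The block sum was bounded with coefficient 1; nonnegativity raises it to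
    8.\<close>
  moreover have "0 \<le> (\<Sum>v\<in>U. real (WB (split_s X T v)))" by (rule sum_nonneg) simp
  ultimately show "real (WB X) \<le> 4 * real (WB (split_c X T U))
        + 8 * (\<Sum>v\<in>U. real (WB (split_s X T v))) + 4 * real (card X)"
    by simp
qed

end
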